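(* Let $t\in\mathbb N$ and let $f\in\mathbb R[Z]^{t\times t}$ be a symmetric matrix polynomial in one variable $Z$ (i.e. $f=f^*$). The following are equivalent: (i) for every $x\in\mathbb R$, the matrix $f(x)$ is not negative semidefinite; (ii) there exist finitely many $p_i\in\mathbb R[Z]^{t\times t}$ such that $\sum_i p_i^*fp_i-1$ is a sum of hermitian squares in $\mathbb R[Z]^{t\times t}$.
   Context: $\mathbb N=\{1,2,\dots\}$. $\mathbb R[Z]^{t\times t}$ is the ring of $t\times t$ matrices over the polynomial ring $\mathbb R[Z]$ in one variable, with involution $*$ the matrix transpose; $1$ denotes the identity matrix. A hermitian square is an element of the form $A^*A$ with $A\in\mathbb R[Z]^{t\times t}$; a sum of hermitian squares is a finite sum of such elements. A matrix $A\in\mathbb R^{t\times t}$ is positive semidefinite if it is symmetric and $v^*Av\ge 0$ for all $v\in\mathbb R^t$, and negative semidefinite if $-A$ is positive semidefinite. *)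

theory Defs
  imports "HOL-Analysis.Analysis" "HOL-Computational_Algebra.Polynomial"
begin

definition symmetric_matrix :: "'a ^ 'n ^ 'n \<Rightarrow> bool" where
  "symmetric_matrix A \<longleftrightarrow> transpose A = A"

definition eval_mat :: "real poly ^ 'n ^ 'm \<Rightarrow> real \<Rightarrow> real ^ 'n ^ 'm" where
  "eval_mat f x = map_matrix (\<lambda>q. poly q x) f"

definition pos_semidef :: "real ^ 'n ^ 'n \<Rightarrow> bool" where
  "pos_semidef A \<longleftrightarrow> symmetric_matrix A \<and> (\<forall>v. v \<bullet> (A *v v) \<ge> 0)"

definition neg_semidef :: "real ^ 'n ^ 'n \<Rightarrow> bool" where
  "neg_semidef A \<longleftrightarrow> pos_semidef (- A)"

definition hermitian_square :: "real poly ^ 'n ^ 'n \<Rightarrow> bool" where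
  "hermitian_square B \<longleftrightarrow> (\<exists>A :: real poly ^ 'n ^ 'n. B = transpose A ** A)"

(* The sum is indexed by an initial segment of the naturals, not by a set of
   matrices, so that repeated summands are allowed; the empty sum 0 is included. *)
definition sum_of_hermitian_squares :: "real poly ^ 'n ^ 'n \<Rightarrow> bool" where
  "sum_of_hermitian_squares B \<longleftrightarrow>
     (\<exists>(m :: nat) S. (\<forall>j<m. hermitian_square (S j)) \<and> B = (\<Sum>j<m. S j))"

end

theory Submission
  imports Defs "HOL-Computational_Algebra.Fundamental_Theorem_Algebra"
begin

text \<open>
  For the nontrivial direction it suffices to find polynomial vectors \<open>v\<^sub>i\<close> such that
  \<open>g = \<Sum>i. v\<^sub>i\<^sup>* f v\<^sub>i\<close> is positive on the whole line: after scaling, \<open>g - 1\<close> is then a sum of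
  squares, and distributing each \<open>v\<^sub>i\<close> over the columns of \<open>t\<close> matrices turns \<open>g\<close> into \<open>g\<close> times the
  identity.  The set \<open>N\<close> of all such \<open>g\<close> is closed under addition and multiplication by squares.
  By hypothesis it has a member positive at any given point; diagonalisation over the polynomials
  ordered by their sign at \<open>\<infinity>\<close> gives members positive near \<open>\<infinity>\<close> and near \<open>-\<infinity>\<close>.  Square weights
  glue these into one member that is positive everywhere.  The converse is seen on a diagonal entry.
\<close>

section \<open>Nonnegative univariate polynomials\<close>

lemma continuous_on_poly_apply: "continuous_on A (poly p)"
  for p :: "'a::real_normed_field poly"
  using continuous_on_poly[OF continuous_on_id] by simp

text \<open>Outside a compact interval a nonconstant polynomial is large in absolute value, hence
  large when nonnegative, so a minimum over the interval is global.\<close>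

lemma nonneg_poly_attains_min:
  fixes p :: "real poly"
  assumes nn: "\<And>x. poly p x \<ge> 0"
  obtains x0 where "\<And>x. poly p x0 \<le> poly p x"
proof (cases "degree p = 0")
  case True
  then obtain c where "p = [:c:]" by (metis degree_eq_zeroE)
  with that[of 0] show ?thesis by simp
next
  case False
  obtain a q where p: "p = pCons a q" by (cases p)
  with False have "q \<noteq> 0" by auto
  from poly_infinity[OF this, of "poly p 0" a] p obtain r
    where r: "\<And>z. r \<le> \<bar>z\<bar> \<Longrightarrow> poly p 0 \<le> \<bar>poly p z\<bar>" by auto
  \<comment> \<open>The radius \<open>max 0 r\<close> keeps 0 in the ball, so the bound
    \<open>poly p 0\<close> valid outside is at least the minimum inside.\<close>
  have ne: "cball (0::real) (max 0 r) \<noteq> {}" by simp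
  obtain x0 where x0: "x0 \<in> cball 0 (max 0 r)" "\<And>y. y \<in> cball 0 (max 0 r) \<Longrightarrow> poly p x0 \<le> poly p y"
    using continuous_attains_inf[OF compact_cball ne, of "poly p", OF continuous_on_poly_apply] by blast
  show ?thesis
  proof (rule that)
    fix x
    show "poly p x0 \<le> poly p x"
    proof (cases "\<bar>x\<bar> \<le> max 0 r")
      case True
      then show ?thesis by (intro x0) auto
    next
      case False
      then have "poly p 0 \<le> poly p x" using r[of x] nn[of x] by auto
      moreover have "poly p x0 \<le> poly p 0" by (intro x0) auto
      ultimately show ?thesis by simp
    qed
  qed
qed

text \<open>Subtracting the minimum leaves a double root, which can be divided out.\<close>
lemma nonneg_poly_eq_min_plus_squares:
  fixes p :: "real poly"
  assumes "\<And>x. poly p x \<ge> 0"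
  shows "\<exists>x0 (n::nat) q. p = [:poly p x0:] + (\<Sum>i<n. (q i)\<^sup>2)"
  using assms
proof (induction "degree p" arbitrary: p rule: less_induct)
  case less
  obtain x0 where min: "\<And>x. poly p x0 \<le> poly p x"
    using nonneg_poly_attains_min[OF less.prems] by blast
  define m where "m = poly p x0"
  show ?case
  proof (cases "degree p = 0")
    case True
    then obtain c where "p = [:c:]" by (metis degree_eq_zeroE)
    \<comment> \<open>\<open>undefined\<close> only fills the summand of an empty sum.\<close>
    then have "p = [:poly p 0:] + (\<Sum>i<(0::nat). (undefined i :: real poly)\<^sup>2)" by simp
    then show ?thesis by blast
  next
    case False
    have "poly (p - [:m:]) x0 = 0" by (simp add: m_def)
    then obtain s where s: "p - [:m:] = [:-x0, 1:] * s"
      by (metis dvdE poly_eq_0_iff_dvd)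
    have p_s: "p = [:m:] + [:-x0, 1:] * s" using s by (simp add: algebra_simps)
    have "poly (pderiv p) x0 = 0"
      by (rule DERIV_local_min[OF poly_DERIV, of 1]) (use min in auto)
    moreover have "poly (pderiv p) x0 = poly s x0"
      unfolding p_s pderiv_add pderiv_mult by (simp add: pderiv_pCons)
    ultimately have "poly s x0 = 0" by simp
    then obtain r where r: "s = [:-x0, 1:] * r"
      by (metis dvdE poly_eq_0_iff_dvd)
    have p_r: "p = [:m:] + [:-x0, 1:]\<^sup>2 * r" by (simp only: p_s r power2_eq_square mult.assoc)
    have off: "poly r x \<ge> 0" if "x \<noteq> x0" for x
    proof -
      have "poly p x = m + (x - x0)\<^sup>2 * poly r x" by (subst p_r) simp
      with min[of x] have "(x - x0)\<^sup>2 * poly r x \<ge> 0" by (simp add: m_def)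
      with that show ?thesis by (simp add: zero_le_mult_iff)
    qed
    \<comment> \<open>At \<open>x0\<close> the squared factor vanishes and says nothing about
      \<open>r\<close>; continuity carries the sign over.\<close>
    have nn: "poly r x \<ge> 0" for x
    proof (cases "x = x0")
      case True
      have "(poly r \<longlongrightarrow> poly r x0) (at x0)" using poly_isCont isCont_def by blast
      moreover have "eventually (\<lambda>x. poly r x \<ge> 0) (at x0)"
        unfolding eventually_at_filter by (auto intro: always_eventually off)
      ultimately show ?thesis unfolding True by (rule tendsto_lowerbound) simp
    qed (rule off)
    have "r \<noteq> 0" using p_r False by auto
    moreover have "[:-x0, 1:]\<^sup>2 \<noteq> 0" "degree ([:-x0, 1:]\<^sup>2) = 2"
      by (auto simp: degree_power_eq)
    ultimately have "degree ([:-x0, 1:]\<^sup>2 * r) = 2 + degree r"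
      using \<open>r \<noteq> 0\<close> by (metis degree_mult_eq)
    moreover from this have "degree ([:m:] + [:-x0, 1:]\<^sup>2 * r) = degree ([:-x0, 1:]\<^sup>2 * r)"
      by (intro degree_add_eq_right) simp
    then have "degree p = degree ([:-x0, 1:]\<^sup>2 * r)" by (simp only: p_r[symmetric])
    ultimately have "degree r < degree p" by simp
    from less.hyps[OF this nn] obtain x1 and n :: nat and q where
      q: "r = [:poly r x1:] + (\<Sum>i<n. (q i)\<^sup>2)" by (elim exE) (rule that)
    have factor: "(\<Sum>i<Suc n. (L * (if i < n then q i else w))\<^sup>2) = L\<^sup>2 * ((\<Sum>i<n. (q i)\<^sup>2) + w\<^sup>2)"
      for L w :: "real poly"
      by (simp add: power_mult_distrib sum_distrib_left distrib_left)
    \<comment> \<open>The constant \<open>poly r x1\<close> is a nonnegative value of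
      \<open>r\<close>; its square root supplies one further square, at index
      \<open>n\<close>.\<close>
    define q' where "q' i = [:-x0, 1:] * (if i < n then q i else [:sqrt (poly r x1):])" for i
    have "(\<Sum>i<Suc n. (q' i)\<^sup>2) = [:-x0, 1:]\<^sup>2 * ((\<Sum>i<n. (q i)\<^sup>2) + [:sqrt (poly r x1):]\<^sup>2)"
      unfolding q'_def by (rule factor)
    also have "[:sqrt (poly r x1):]\<^sup>2 = [:poly r x1:]"
      using nn[of x1] by (simp add: power2_eq_square)
    also have "(\<Sum>i<n. (q i)\<^sup>2) + [:poly r x1:] = r" by (metis q add.commute)
    finally have "p = [:poly p x0:] + (\<Sum>i<Suc n. (q' i)\<^sup>2)" using p_r by (simp only: m_def)
    then show ?thesis by blast
  qed
qed

text \<open>The constant in the decomposition of \<open>g\<close> is a value of \<open>g\<close>,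
  hence positive; the square of its inverse root scales it to 1.\<close>

lemma pos_poly_minus_one_sum_squares:
  fixes g :: "real poly"
  assumes "\<And>x. poly g x > 0"
  obtains c n q where "[:c:]\<^sup>2 * g - 1 = (\<Sum>i<(n::nat). (q i)\<^sup>2)"
proof -
  obtain x0 and n :: nat and q where q: "g = [:poly g x0:] + (\<Sum>i<n. (q i)\<^sup>2)"
    using nonneg_poly_eq_min_plus_squares[OF less_imp_le[OF assms]] by (elim exE) (rule that)
  define c where "c = 1 / sqrt (poly g x0)"
  have c: "c\<^sup>2 * poly g x0 = 1"
    using assms[of x0] by (simp add: c_def power_divide)
  have "[:c:]\<^sup>2 * [:poly g x0:] = [:c\<^sup>2 * poly g x0:]"
    by (simp add: power2_eq_square mult.assoc)
  then have unit: "[:c:]\<^sup>2 * [:poly g x0:] = 1" unfolding c by simp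
  have "[:c:]\<^sup>2 * g = [:c:]\<^sup>2 * ([:poly g x0:] + (\<Sum>i<n. (q i)\<^sup>2))"
    using q by (rule arg_cong)
  also have "\<dots> = 1 + (\<Sum>i<n. ([:c:] * q i)\<^sup>2)"
    unfolding distrib_left unit by (simp only: sum_distrib_left power_mult_distrib)
  finally have "[:c:]\<^sup>2 * g - 1 = (\<Sum>i<n. ([:c:] * q i)\<^sup>2)"
    by (simp only: add_diff_cancel_left')
  then show ?thesis by (rule that)
qed

section \<open>Behaviour of real polynomials near both infinities\<close>

definition reflect_arg :: "real poly \<Rightarrow> real poly" where
  "reflect_arg p = pcompose p [:0, -1:]"

lemma poly_reflect_arg [simp]: "poly (reflect_arg p) x = poly p (- x)"
  by (simp add: reflect_arg_def poly_pcompose)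

text \<open>A positive value of this coefficient is how positivity near -\<infinity> is expressed
  below; the parity of the degree decides whether both ends agree in sign.\<close>

lemma lead_coeff_reflect_arg: "lead_coeff (reflect_arg p) = (-1) ^ degree p * lead_coeff p"
  by (simp add: reflect_arg_def lead_coeff_comp)

text \<open>In even degree reflection preserves the leading coefficient, so the bound near
  \<infinity> also applies near -\<infinity>.\<close>

lemma even_degree_eventually_ge:
  fixes h :: "real poly"
  assumes "even (degree h)" "lead_coeff h > 0"
  obtains R where "R \<ge> 1" "\<And>x. \<bar>x\<bar> \<ge> R \<Longrightarrow> poly h x \<ge> lead_coeff h"
proof -
  obtain r1 where r1: "\<And>x. x \<ge> r1 \<Longrightarrow> poly h x \<ge> lead_coeff h"
    using poly_pinfty_gt_lc[OF assms(2)] by blast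
  have l: "lead_coeff (reflect_arg h) = lead_coeff h" using assms(1) by (simp add: lead_coeff_reflect_arg)
  obtain r2 where r2: "\<And>x. x \<ge> r2 \<Longrightarrow> poly (reflect_arg h) x \<ge> lead_coeff h"
    using poly_pinfty_gt_lc[of "reflect_arg h"] assms(2) unfolding l by blast
  show ?thesis
  proof (rule that[of "max 1 (max r1 r2)"])
    fix x :: real assume "\<bar>x\<bar> \<ge> max 1 (max r1 r2)"
    then show "poly h x \<ge> lead_coeff h" using r1[of x] r2[of "-x"] by (cases "x \<ge> 0") auto
  qed simp
qed

text \<open>Away from the unit interval every monomial of degree at most \<open>d\<close> is
  dominated by the power \<open>2 * d\<close>; the even exponent makes the bound comparable with
  squares.\<close>

lemma poly_le_even_power:
  fixes g :: "real poly"
  obtains C d where "C > 0" "\<And>x. \<bar>x\<bar> \<ge> 1 \<Longrightarrow> \<bar>poly g x\<bar> \<le> C * x ^ (2 * d)"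
proof
  define d where "d = degree g"
  define C where "C = 1 + (\<Sum>i\<le>d. \<bar>coeff g i\<bar>)"
  show "C > 0" unfolding C_def by (smt (verit) sum_nonneg abs_ge_zero)
  fix x :: real assume x: "\<bar>x\<bar> \<ge> 1"
  have "\<bar>poly g x\<bar> \<le> (\<Sum>i\<le>d. \<bar>coeff g i * x ^ i\<bar>)"
    unfolding poly_altdef d_def by (rule sum_abs)
  also have "\<dots> \<le> (\<Sum>i\<le>d. \<bar>coeff g i\<bar> * x ^ (2*d))"
  proof (rule sum_mono)
    fix i assume "i \<in> {..d}"
    then have "\<bar>x\<bar> ^ i \<le> \<bar>x\<bar> ^ (2*d)" using x by (intro power_increasing) auto
    also have "\<dots> = x ^ (2*d)" by (simp add: power_even_abs)
    finally show "\<bar>coeff g i * x ^ i\<bar> \<le> \<bar>coeff g i\<bar> * x ^ (2*d)"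
      by (simp add: abs_mult power_abs mult_left_mono)
  qed
  also have "\<dots> \<le> C * x ^ (2*d)"
    unfolding C_def sum_distrib_right[symmetric] by (simp add: mult_right_mono)
  finally show "\<bar>poly g x\<bar> \<le> C * x ^ (2 * d)" .
qed

section \<open>Sets of polynomials closed under addition and multiplication by squares\<close>

text \<open>A quadratic module without the demand that 1 belong to it. The gluing below rests on
  these closure properties alone.\<close>

locale square_cone =
  fixes N :: "real poly set"
  assumes zero_mem: "0 \<in> N"
    and add_mem: "g \<in> N \<Longrightarrow> h \<in> N \<Longrightarrow> g + h \<in> N"
    and square_mult_mem: "g \<in> N \<Longrightarrow> q\<^sup>2 * g \<in> N"
begin

lemma sum_mem: "(\<And>i. i \<in> I \<Longrightarrow> g i \<in> N) \<Longrightarrow> sum g I \<in> N"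
  by (induction I rule: infinite_finite_induct) (auto simp: zero_mem add_mem)

lemma scale_mem:
  assumes "g \<in> N" "c \<ge> 0" shows "[:c:] * g \<in> N"
  using square_mult_mem[OF assms(1), of "[:sqrt c:]"] assms(2) by (simp add: power2_eq_square)

text \<open>Two members of odd degree, one positive near \<open>\<infinity>\<close> and one near \<open>-\<infinity>\<close>, are normalised to
  \<open>p\<close> and \<open>q\<close> of equal degree and opposite leading coefficients.  In
  \<open>(z + c)\<^sup>2 p + (z - c)\<^sup>2 q\<close> the leading terms cancel, and for large \<open>c\<close> the next coefficient
  is positive.\<close>
lemma pos_near_both_infinities:
  assumes p: "p \<in> N" "lead_coeff p > 0" and q: "q \<in> N" "lead_coeff (reflect_arg q) > 0"
  obtains h where "h \<in> N" "even (degree h)" "lead_coeff h > 0"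
proof (cases "even (degree p) \<or> even (degree q)")
  case True
  then show ?thesis using that p q by (auto simp: lead_coeff_reflect_arg)
next
  case False
  define a where "a = lead_coeff p"
  define b where "b = - lead_coeff q"
  have ab: "a > 0" "b > 0" using False p q by (auto simp: a_def b_def lead_coeff_reflect_arg)
  obtain k l where k: "degree p = 2 * k + 1" and l: "degree q = 2 * l + 1"
    using False by (meson oddE)
  define n where "n = 2 * (k + l) + 1"
  \<comment> \<open>Squared monomials raise both degrees to \<open>n\<close>; the factors
    \<open>b\<close> and \<open>a\<close> make the leading coefficients \<open>a * b\<close> and
    \<open>- (a * b)\<close>.\<close>
  define P where "P = [:b:] * ((monom 1 l)\<^sup>2 * p)"
  define Q where "Q = [:a:] * ((monom 1 k)\<^sup>2 * q)"
  have PQ: "P \<in> N" "Q \<in> N"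
    unfolding P_def Q_def by (intro scale_mem square_mult_mem; use ab p q in simp)+
  have nz: "p \<noteq> 0" "q \<noteq> 0" using k l by auto
  have dm: "degree ((monom (1::real) j)\<^sup>2) = 2 * j" for j
    by (simp add: monom_power degree_monom_eq)
  have dP: "degree P = n"
    using ab nz k dm[of l] by (simp add: P_def n_def degree_mult_eq)
  have dQ: "degree Q = n"
    using ab nz l dm[of k] by (simp add: Q_def n_def degree_mult_eq)
  have lm: "lead_coeff ((monom (1::real) j)\<^sup>2) = 1" for j
    by (simp add: monom_power degree_monom_eq)
  have cP: "coeff P n = a * b"
  proof -
    have "lead_coeff P = b * (1 * a)" unfolding P_def lead_coeff_mult lm by (simp add: a_def)
    then show ?thesis by (simp add: dP)
  qed
  have cQ: "coeff Q n = - (a * b)"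
  proof -
    have "lead_coeff Q = a * (1 * - b)" unfolding Q_def lead_coeff_mult lm by (simp add: b_def)
    then show ?thesis by (simp add: dQ)
  qed
  define u where "u = coeff P (n - 1) + coeff Q (n - 1)"
  \<comment> \<open>The coefficient of \<open>h\<close> at \<open>n + 1\<close> will be
    \<open>u + 4 * c * (a * b)\<close>; this \<open>c\<close> makes it
    \<open>u + \<bar>u\<bar> + 1\<close>.\<close>
  define c where "c = (\<bar>u\<bar> + 1) / (4 * (a * b))"
  have c: "4 * c * (a * b) = \<bar>u\<bar> + 1" using ab by (simp add: c_def)
  define h where "h = [:c, 1:]\<^sup>2 * P + [:-c, 1:]\<^sup>2 * Q"
  have "h \<in> N" unfolding h_def by (intro add_mem square_mult_mem PQ)
  \<comment> \<open>This separates \<open>P + Q\<close>, whose coefficient at \<open>n\<close>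
    cancels, from \<open>P - Q\<close>, whose coefficient there is
    \<open>2 * (a * b)\<close>.\<close>
  have expand: "h = monom 1 2 * (P + Q) + (smult (2 * c) (monom 1 1 * (P - Q)) + smult (c\<^sup>2) (P + Q))"
  proof -
    have 1: "[:e, 1:]\<^sup>2 = monom 1 2 + (smult (2 * e) (monom 1 1) + [:e\<^sup>2:])" for e :: real
      by (simp add: power2_eq_square monom_altdef numeral_2_eq_2)
    show ?thesis unfolding h_def 1 by (simp add: algebra_simps smult_add_right smult_diff_right)
  qed
  have n1: "n \<ge> 1" by (simp add: n_def)
  have top: "coeff h (n + 1) = u + 4 * c * (a * b)"
    using n1 unfolding expand by (simp add: coeff_monom_mult u_def cP cQ dP dQ coeff_eq_0)
  have "coeff h i = 0" if "i > n + 1" for i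
  proof -
    have "i - 2 = n \<or> i - 2 > n" using that by linarith
    then have "coeff (P + Q) (i - 2) = 0"
    proof
      assume "i - 2 = n"
      then show ?thesis by (simp only: coeff_add cP cQ add.right_inverse)
    qed (simp add: dP dQ coeff_eq_0)
    moreover have "coeff P i = 0" "coeff Q i = 0" "coeff P (i - 1) = 0" "coeff Q (i - 1) = 0"
      using that by (auto intro!: coeff_eq_0 simp: dP dQ)
    ultimately show ?thesis using that n1 unfolding expand by (simp add: coeff_monom_mult)
  qed
  then have "degree h \<le> n + 1" by (intro degree_le) auto
  moreover have pos: "coeff h (n + 1) > 0" unfolding top c by linarith
  ultimately have "degree h = n + 1" by (metis le_antisym le_degree less_numeral_extra(3))
  with pos \<open>h \<in> N\<close> show ?thesis by (intro that[of h]) (auto simp: n_def)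
qed

text \<open>The members positive somewhere are summed with weights \<open>max 0 g\<close>, whose square roots are
  approximated by polynomials.\<close>
lemma pos_on_compact:
  assumes K: "compact K" and pt: "\<And>x. x \<in> K \<Longrightarrow> \<exists>g\<in>N. poly g x > 0"
  obtains g where "g \<in> N" "\<And>x. x \<in> K \<Longrightarrow> poly g x > 0"
proof -
  \<comment> \<open>Exceeding 1 rather than 0 gives a uniform lower bound on each set of the open
    cover.\<close>
  have pt1: "\<exists>g\<in>N. poly g x > 1" if "x \<in> K" for x
  proof -
    obtain g where g: "g \<in> N" "poly g x > 0" using pt[OF \<open>x \<in> K\<close>] by blast
    then have "poly ([:2 / poly g x:] * g) x > 1" by simp
    with scale_mem[OF g(1), of "2 / poly g x"] g(2) show ?thesis
      by (intro bexI[of _ "[:2 / poly g x:] * g"]) auto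
  qed
  have op: "open {x. poly g x > 1}" for g :: "real poly"
    by (intro open_Collect_less continuous_intros)
  obtain G where G: "G \<subseteq> N" "finite G" "K \<subseteq> (\<Union>g\<in>G. {x. poly g x > 1})"
  proof (rule compactE_image[OF K, of N "\<lambda>g. {x. poly g x > 1}"])
    show "K \<subseteq> (\<Union>g\<in>N. {x. poly g x > 1})" using pt1 by blast
  qed (use op in auto)
  have "\<exists>M. \<forall>x\<in>K. \<bar>poly g x\<bar> \<le> M" for g :: "real poly"
  proof -
    have "bounded (poly g ` K)"
      by (intro compact_imp_bounded compact_continuous_image K continuous_on_poly_apply)
    then show ?thesis by (auto simp: bounded_iff)
  qed
  then obtain B where B: "\<And>g x. x \<in> K \<Longrightarrow> \<bar>poly g x\<bar> \<le> B g" by metis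
  define M where "M = 1 + (\<Sum>g\<in>G. \<bar>B g\<bar>)"
  have Mpos: "M > 0" unfolding M_def by (smt (verit) sum_nonneg abs_ge_zero)
  have M: "\<bar>poly g x\<bar> \<le> M" if "g \<in> G" "x \<in> K" for g x
    proof -
    have "\<bar>B g\<bar> \<le> (\<Sum>g\<in>G. \<bar>B g\<bar>)" by (rule member_le_sum[OF that(1)]) (use G(2) in auto)
    then show ?thesis using B[OF that(2), of g] by (simp add: M_def)
  qed
  \<comment> \<open>\<open>e\<close> keeps the total loss \<open>card G * (e * M)\<close> below 1/4.
    \<open>d \<le> 1/2\<close> keeps the approximate root at least 1/2 where \<open>g\<close>
    exceeds 1, and \<open>d\<^sup>2 \<le> e\<close> bounds the weight where \<open>g\<close> is
    negative.\<close>
  define e where "e = 1 / (4 * (real (card G) + 1) * (M + 1))"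
  define d where "d = min (1/2) (sqrt e)"
  have e: "e > 0" using Mpos by (simp add: e_def)
  have d: "d > 0" "d \<le> 1/2" "d\<^sup>2 \<le> e"
  proof -
    show "d > 0" "d \<le> 1/2" using e by (auto simp: d_def)
    then have "d\<^sup>2 \<le> (sqrt e)\<^sup>2" by (intro power_mono) (auto simp: d_def)
    then show "d\<^sup>2 \<le> e" using e by simp
  qed
  have "\<exists>q. \<forall>x\<in>K. \<bar>sqrt (max 0 (poly g x)) - poly q x\<bar> < d" for g :: "real poly"
  proof -
    have "continuous_on K (\<lambda>x. sqrt (max 0 (poly g x)))" by (intro continuous_intros)
    then obtain r where r: "real_polynomial_function r" "\<And>x. x \<in> K \<Longrightarrow> \<bar>sqrt (max 0 (poly g x)) - r x\<bar> < d"
      using Stone_Weierstrass_real_polynomial_function[OF K _ d(1)] by metis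
    then obtain a n where "r = (\<lambda>x. \<Sum>i\<le>n. a i * x ^ i)" by (auto simp: real_polynomial_function_iff_sum)
    then have "r x = poly (\<Sum>i\<le>n. monom (a i) i) x" for x by (simp add: poly_sum poly_monom)
    with r show ?thesis by metis
  qed
  then obtain q where q: "\<And>g x. x \<in> K \<Longrightarrow> \<bar>sqrt (max 0 (poly g x)) - poly (q g) x\<bar> < d" by metis
  define h where "h = (\<Sum>g\<in>G. (q g)\<^sup>2 * g)"
  have "h \<in> N" unfolding h_def using G(1) by (intro sum_mem square_mult_mem) auto
  moreover have "poly h x > 0" if x: "x \<in> K" for x
  proof -
    obtain g where g: "g \<in> G" "poly g x > 1" using G(3) x by blast
    \<comment> \<open>Where \<open>g'\<close> is negative, the approximated root is 0, so the weight
      is at most \<open>e\<close>.\<close>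
    have low: "(poly (q g') x)\<^sup>2 * poly g' x \<ge> - (e * M)" if "g' \<in> G" for g'
    proof (cases "poly g' x \<ge> 0")
      case True
      then have "(poly (q g') x)\<^sup>2 * poly g' x \<ge> 0" by simp
      moreover have "e * M \<ge> 0" using e Mpos by simp
      ultimately show ?thesis by linarith
    next
      case False
      then have "\<bar>poly (q g') x\<bar> < d" using q[OF x, of g'] by simp
      then have "(poly (q g') x)\<^sup>2 \<le> d\<^sup>2" using abs_le_square_iff d(1) by (metis abs_of_pos less_imp_le)
      with d(3) have "(poly (q g') x)\<^sup>2 \<le> e" by linarith
      then have "(poly (q g') x)\<^sup>2 * - poly g' x \<le> e * M"
        using M[OF that x] e False by (intro mult_mono) auto
      then show ?thesis by simp
    qed
    have "sqrt (poly g x) > 1" using g(2) by simp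
    moreover have "max 0 (poly g x) = poly g x" using g(2) by simp
    with q[OF x, of g] have "\<bar>sqrt (poly g x) - poly (q g) x\<bar> < d" by (simp only:)
    ultimately have "poly (q g) x \<ge> 1/2" using d(2) by linarith
    then have "(poly (q g) x)\<^sup>2 \<ge> (1/2)\<^sup>2" by (intro power_mono) auto
    then have "(poly (q g) x)\<^sup>2 * poly g x \<ge> (1/2)\<^sup>2 * 1" using g(2) by (intro mult_mono) auto
    then have big: "(poly (q g) x)\<^sup>2 * poly g x \<ge> 1/4" by (simp add: power2_eq_square)
    have "poly h x = (\<Sum>g\<in>G. (poly (q g) x)\<^sup>2 * poly g x)" by (simp add: h_def poly_sum)
    also have "\<dots> = (poly (q g) x)\<^sup>2 * poly g x + (\<Sum>g\<in>G - {g}. (poly (q g) x)\<^sup>2 * poly g x)"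
      using G(2) g(1) by (rule sum.remove)
    finally have "poly h x \<ge> 1/4 + (\<Sum>g\<in>G - {g}. (poly (q g) x)\<^sup>2 * poly g x)"
      using big by simp
    moreover have "(\<Sum>g\<in>G - {g}. (poly (q g) x)\<^sup>2 * poly g x) \<ge> (\<Sum>g\<in>G - {g}. - (e * M))"
      by (intro sum_mono low) auto
    ultimately have "poly h x \<ge> 1/4 - real (card (G - {g})) * (e * M)" by simp
    moreover have "real (card (G - {g})) * (e * M) \<le> real (card G) * (e * M)"
      using e Mpos G(2) by (intro mult_right_mono) (auto intro: card_mono)
    moreover have "real (card G) * (e * M) < 1/4"
    proof -
      have "real (card G) * M < (real (card G) + 1) * (M + 1)" using Mpos by (simp add: algebra_simps)
      moreover have "(real (card G) + 1) * (M + 1) > 0" using Mpos by simp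
      ultimately show ?thesis by (simp add: e_def field_simps)
    qed
    ultimately show ?thesis by linarith
  qed
  ultimately show ?thesis using that by blast
qed

text \<open>The member \<open>h\<close> that is positive near infinity is multiplied by \<open>\<epsilon> (z / 2R)\<^sup>2\<^sup>m\<close>, which is small
  where \<open>h\<close> may be negative and outgrows \<open>g\<close> where \<open>g\<close> may be negative.\<close>
lemma pos_everywhere:
  assumes pt: "\<And>x. \<exists>g\<in>N. poly g x > 0"
    and pinf: "\<exists>g\<in>N. lead_coeff g > 0" and minf: "\<exists>g\<in>N. lead_coeff (reflect_arg g) > 0"
  obtains g where "g \<in> N" "\<And>x. poly g x > 0"
proof -
  obtain h where h: "h \<in> N" "even (degree h)" "lead_coeff h > 0"
    using pos_near_both_infinities pinf minf by metis
  define l where "l = lead_coeff h"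
  obtain R where R: "R \<ge> 1" "\<And>x. \<bar>x\<bar> \<ge> R \<Longrightarrow> poly h x \<ge> l"
    using even_degree_eventually_ge[OF h(2,3)] unfolding l_def by blast
  have l: "l > 0" using h by (simp add: l_def)
  \<comment> \<open>Positivity of \<open>g\<close> up to \<open>3 * R\<close> and of
    \<open>h\<close> from \<open>R\<close> on leaves a region where both are positive, in which
    \<open>s\<close> passes from small to large.\<close>
  obtain g where g: "g \<in> N" "\<And>x. x \<in> cball 0 (3 * R) \<Longrightarrow> poly g x > 0"
    using pos_on_compact[OF compact_cball[of 0 "3*R"] pt] by blast
  have ne: "cball 0 R \<noteq> {}" using R by simp
  obtain x1 where x1: "x1 \<in> cball 0 R" "\<And>y. y \<in> cball 0 R \<Longrightarrow> poly g x1 \<le> poly g y"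
    using continuous_attains_inf[OF compact_cball ne, of "poly g", OF continuous_on_poly_apply] by blast
  define m0 where "m0 = poly g x1"
  have m0: "m0 > 0" using g(2)[of x1] x1(1) R(1) by (auto simp: m0_def)
  have "bounded (poly h ` cball 0 R)"
    by (intro compact_imp_bounded compact_continuous_image compact_cball continuous_on_poly_apply)
  then obtain H where H: "H > 0" "\<And>x. \<bar>x\<bar> \<le> R \<Longrightarrow> \<bar>poly h x\<bar> \<le> H"
    by (auto simp: bounded_pos)
  \<comment> \<open>Within radius \<open>R\<close> the square of \<open>s\<close> is at most 1, so
    the first summand of \<open>F\<close> costs at most \<open>e * H\<close>, half the minimum
    \<open>m0\<close> of \<open>g\<close> there.\<close>
  define e where "e = m0 / (2 * H)"
  have e: "e > 0" "e * H < m0" using m0 H(1) by (auto simp: e_def)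
  obtain C d where C: "C > 0" "\<And>x. \<bar>x\<bar> \<ge> 1 \<Longrightarrow> \<bar>poly g x\<bar> \<le> C * x ^ (2 * d)"
    using poly_le_even_power by blast
  \<comment> \<open>Beyond \<open>3 * R\<close> each factor \<open>(x / (2*R))\<^sup>2\<close> is at
    least 9/4: \<open>d\<close> of them match the growth of \<open>g\<close> and \<open>k\<close>
    more absorb the constants.\<close>
  obtain k where k: "C * (2*R) ^ (2*d) / (e * l) < (9/4::real) ^ k"
    using real_arch_pow[of "9/4"] by auto
  define s where "s = smult (1 / (2*R) ^ (d + k)) (monom 1 (d + k))"
  have s: "(poly s x)\<^sup>2 = (x / (2*R)) ^ (2 * (d + k))" for x
    by (simp add: s_def poly_monom power_divide power_mult_distrib mult.commute flip: power_mult)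
  define F where "F = [:e:] * (s\<^sup>2 * h) + g"
  have "F \<in> N" unfolding F_def using e h g by (intro add_mem scale_mem square_mult_mem) auto
  moreover have "poly F x > 0" for x
  proof -
    define t where "t = (poly s x)\<^sup>2"
    have t0: "t \<ge> 0" by (simp add: t_def)
    have F: "poly F x = e * (t * poly h x) + poly g x" by (simp add: F_def t_def)
    consider "\<bar>x\<bar> \<le> R" | "R < \<bar>x\<bar>" "\<bar>x\<bar> \<le> 3 * R" | "3 * R < \<bar>x\<bar>" by linarith
    then show ?thesis
    proof cases
      case 1
      have "t = \<bar>x / (2*R)\<bar> ^ (2 * (d + k))" unfolding t_def s by (rule power_even_abs[symmetric]) simp
      also have "\<dots> \<le> 1" using 1 R(1) by (intro power_le_one) auto
      finally have "t * \<bar>poly h x\<bar> \<le> 1 * H" using H(2)[OF 1] H(1) by (intro mult_mono) auto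
      then have "\<bar>e * (t * poly h x)\<bar> \<le> e * H" using e t0 by (simp add: abs_mult)
      moreover have "m0 \<le> poly g x" unfolding m0_def using 1 by (intro x1) simp
      ultimately show ?thesis unfolding F using e(2) by linarith
    next
      case 2
      then have "poly g x > 0" by (intro g) simp
      moreover have "poly h x > 0" using R(2)[of x] 2 l by simp
      ultimately show ?thesis unfolding F using e t0 by (intro add_nonneg_pos) auto
    next
      case 3
      have x2: "x\<^sup>2 \<ge> (3*R)\<^sup>2" using 3 R(1) by (metis abs_le_square_iff abs_of_nonneg less_imp_le
            mult_nonneg_nonneg order_trans zero_le_numeral zero_le_one)
      have "(x / (2*R))\<^sup>2 \<ge> 9/4" using x2 R(1) by (simp add: field_simps power2_eq_square)
      then have "((x / (2*R))\<^sup>2) ^ k \<ge> (9/4) ^ k" by (intro power_mono) auto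
      then have "(x / (2*R)) ^ (2*d) * (9/4) ^ k \<le> t"
        unfolding t_def s by (simp add: distrib_left power_add power_mult mult_left_mono)
      moreover have "x ^ (2*d) > 0" using 3 R(1) by (auto simp: zero_less_power_eq)
      then have "(x / (2*R)) ^ (2*d) * (C * (2*R) ^ (2*d) / (e * l)) < (x / (2*R)) ^ (2*d) * (9/4) ^ k"
        using k R(1) by (intro mult_strict_left_mono) (auto simp: power_divide)
      moreover have "(x / (2*R)) ^ (2*d) * (C * (2*R) ^ (2*d) / (e * l)) = C * x ^ (2*d) / (e * l)"
        using R(1) by (simp add: power_divide)
      ultimately have "C * x ^ (2*d) / (e * l) < t" by linarith
      then have "C * x ^ (2*d) < e * (t * l)" using e(1) l by (simp add: field_simps)
      moreover have "e * (t * l) \<le> e * (t * poly h x)"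
        using R(2)[of x] 3 R(1) e(1) t0 by (intro mult_left_mono) auto
      ultimately show ?thesis unfolding F using C(2)[of x] 3 R(1) by auto
    qed
  qed
  ultimately show ?thesis using that by blast
qed

end

section \<open>Quadratic forms with polynomial coefficients\<close>

text \<open>Coefficients and vectors are functions and the index set is explicit, so that variables
  can be eliminated by induction over \<open>S\<close>.\<close>

definition qform :: "('i \<Rightarrow> 'i \<Rightarrow> 'a::comm_ring_1) \<Rightarrow> 'i set \<Rightarrow> ('i \<Rightarrow> 'a) \<Rightarrow> 'a" where
  "qform a S v = (\<Sum>i\<in>S. \<Sum>j\<in>S. v i * a i j * v j)"

lemma qform_insert:
  assumes "finite S" "k \<notin> S" and sym: "\<And>i j. a i j = a j i"
  shows "qform a (insert k S) v =
    a k k * (v k)\<^sup>2 + 2 * v k * (\<Sum>j\<in>S. a k j * v j) + qform a S v"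
proof -
  have "(\<Sum>i\<in>S. v i * a i k * v k) = v k * (\<Sum>j\<in>S. a k j * v j)"
    unfolding sum_distrib_left by (intro sum.cong refl) (simp add: sym[of _ k] mult_ac)
  moreover have "(\<Sum>j\<in>S. v k * a k j * v j) = v k * (\<Sum>j\<in>S. a k j * v j)"
    unfolding sum_distrib_left by (intro sum.cong refl) (simp add: mult_ac)
  ultimately show ?thesis
    using assms(1,2) by (simp add: qform_def sum.distrib power2_eq_square algebra_simps)
qed

lemma qform_cong: "(\<And>i. i \<in> S \<Longrightarrow> v i = w i) \<Longrightarrow> qform a S v = qform a S w"
  unfolding qform_def by (intro sum.cong) auto

lemma qform_scale: "qform a S (\<lambda>i. c * v i) = c\<^sup>2 * qform a S v"
  unfolding qform_def sum_distrib_left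
  by (intro sum.cong refl) (simp add: power2_eq_square mult_ac)

lemma qform_single:
  assumes "finite S" "i \<in> S"
  shows "qform a S (\<lambda>j. if j = i then 1 else 0) = a i i"
proof -
  have "(\<Sum>l\<in>S. (if j = i then 1 else 0) * a j l * (if l = i then 1 else 0)) =
      (if j = i then a i i else 0)" for j
    using assms by (simp add: if_distrib cong: if_cong)
  then show ?thesis using assms by (simp add: qform_def)
qed

text \<open>For \<open>b = a k\<close> and \<open>d = a k k\<close> the coefficients on the left are
  \<open>- d\<close> times the Schur complement of the pivot: denominators are cleared, and the sign
  is kept when \<open>d\<close> is negative.\<close>

lemma qform_schur:
  "qform (\<lambda>i j. b i * b j - d * a i j) S v = (\<Sum>j\<in>S. b j * v j)\<^sup>2 - d * qform a S v"
  by (simp add: qform_def power2_eq_square sum_product sum_distrib_left sum_subtractf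
      left_diff_distrib right_diff_distrib mult_ac)

lemma poly_qform:
  "poly (qform a S v) x = qform (\<lambda>i j. poly (a i j) x) S (\<lambda>i. poly (v i) x)"
  by (simp add: qform_def poly_sum)

lemma lead_coeff_mult_pos:
  fixes p q :: "real poly"
  shows "lead_coeff p > 0 \<Longrightarrow> lead_coeff q > 0 \<Longrightarrow> lead_coeff (p * q) > 0"
  by (simp add: lead_coeff_mult)

lemma eventually_poly_pos:
  fixes p :: "real poly"
  assumes "lead_coeff p > 0"
  shows "eventually (\<lambda>x. poly p x > 0) at_top"
proof -
  obtain n where "\<forall>x\<ge>n. lead_coeff p \<le> poly p x" using poly_pinfty_gt_lc[OF assms] by blast
  then show ?thesis unfolding eventually_at_top_linorder using assms by force
qed

text \<open>Gaussian elimination over the polynomials ordered by the sign at \<open>\<infinity>\<close>: a negative pivot is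
  eliminated by a Schur complement, cleared of denominators.\<close>
lemma eventually_qform_nonpos_or_pos_vector:
  fixes a :: "'i \<Rightarrow> 'i \<Rightarrow> real poly"
  assumes "finite S" "\<And>i j. a i j = a j i"
  shows "(\<exists>v. lead_coeff (qform a S v) > 0) \<or>
    eventually (\<lambda>x. \<forall>w. qform (\<lambda>i j. poly (a i j) x) S w \<le> 0) at_top"
  using assms
proof (induction S arbitrary: a rule: finite_induct)
  case empty
  then show ?case by (simp add: qform_def)
next
  case (insert k S)
  note ins = qform_insert[OF insert.hyps(1,2) insert.prems]
  have ins_x: "qform (\<lambda>i j. poly (a i j) x) (insert k S) w = poly (a k k) x * (w k)\<^sup>2 +
      2 * w k * (\<Sum>j\<in>S. poly (a k j) x * w j) + qform (\<lambda>i j. poly (a i j) x) S w" for x w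
    using insert.prems by (intro qform_insert insert.hyps) metis
  consider "lead_coeff (a k k) > 0" | "a k k = 0" | "lead_coeff (a k k) < 0"
    by (metis leading_coeff_0_iff linorder_neqE_linordered_idom)
  then show ?case
  proof cases
    case 1
    moreover have "qform a (insert k S) (\<lambda>j. if j = k then 1 else 0) = a k k"
      using insert.hyps by (intro qform_single) auto
    ultimately have "lead_coeff (qform a (insert k S) (\<lambda>j. if j = k then 1 else 0)) > 0"
      by (simp only:)
    then show ?thesis by blast
  next
    case 2
    show ?thesis
    proof (cases "\<exists>i\<in>S. a k i \<noteq> 0")
      case True
      then obtain i where i: "i \<in> S" "a k i \<noteq> 0" by blast
      \<comment> \<open>The value at \<open>v\<close> is \<open>a i i\<close> plus
        \<open>2 * (a k i)\<^sup>2\<close> times the \<open>m\<close>-th power of the variable; this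
        \<open>m\<close> makes the second term dominate.\<close>
      define m where "m = degree (a i i) + 1"
      define v where "v j = (if j = k then monom 1 m * a k i else if j = i then 1 else 0)" for j
      have nk: "j \<in> S \<Longrightarrow> j \<noteq> k" for j using insert.hyps by auto
      have "(\<Sum>j\<in>S. a k j * v j) = (\<Sum>j\<in>S. if j = i then a k i else 0)"
        using nk by (intro sum.cong) (auto simp: v_def)
      also have "\<dots> = a k i" using i insert.hyps by simp
      finally have lin: "(\<Sum>j\<in>S. a k j * v j) = a k i" .
      have "qform a S v = qform a S (\<lambda>j. if j = i then 1 else 0)"
        using nk by (intro qform_cong) (auto simp: v_def)
      also have "\<dots> = a i i" using i insert.hyps by (intro qform_single)
      finally have "qform a (insert k S) v = 2 * (monom 1 m * a k i) * a k i + a i i"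
        unfolding ins lin by (simp add: 2 v_def)
      also have "\<dots> = a i i + monom 2 m * (a k i * a k i)"
      proof -
        have "monom 2 m = 2 * monom (1::real) m" by (simp only: mult_2 add_monom one_add_one)
        then show ?thesis by (simp add: mult_ac)
      qed
      finally have q: "qform a (insert k S) v = a i i + monom 2 m * (a k i * a k i)" .
      have "degree (a i i) < degree (monom 2 m * (a k i * a k i))"
        using i by (simp add: degree_mult_eq degree_monom_eq m_def)
      then have "lead_coeff (qform a (insert k S) v) = lead_coeff (monom 2 m * (a k i * a k i))"
        unfolding q by (rule lead_coeff_add_le)
      also have "\<dots> > 0"
        using i by (simp only: lead_coeff_mult) (simp add: degree_monom_eq zero_less_mult_iff linorder_neq_iff[symmetric])
      finally show ?thesis by blast
    next
      case False
      then have z: "a k j = 0" if "j \<in> S" for j using that by blast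
      have "qform a (insert k S) v = qform a S v" for v
        unfolding ins by (simp add: 2 z)
      moreover have "qform (\<lambda>i j. poly (a i j) x) (insert k S) w = qform (\<lambda>i j. poly (a i j) x) S w" for x w
        unfolding ins_x by (simp add: 2 z)
      ultimately show ?thesis using insert.IH[OF insert.prems] by simp
    qed
  next
    case 3
    define d where "d = a k k"
    have d: "lead_coeff (- d) > 0" using 3 by (simp add: d_def)
    define a' where "a' i j = a k i * a k j - d * a i j" for i j
    have sym': "a' i j = a' j i" for i j
      unfolding a'_def using insert.prems[of i j] by (simp add: mult_ac)
    have a'_x: "qform (\<lambda>i j. poly (a' i j) x) S w =
        (\<Sum>j\<in>S. poly (a k j) x * w j)\<^sup>2 - poly d x * qform (\<lambda>i j. poly (a i j) x) S w" for x w
      unfolding a'_def poly_diff poly_mult by (rule qform_schur)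
    from insert.IH[of a', OF sym'] show ?thesis
    proof
      assume "\<exists>v. lead_coeff (qform a' S v) > 0"
      then obtain v where v: "lead_coeff (qform a' S v) > 0" by blast
      define B where "B = (\<Sum>j\<in>S. a k j * v j)"
      \<comment> \<open>For fixed \<open>v\<close> the form is largest at the \<open>k\<close>-th
        coordinate \<open>- B / d\<close>. Scaling that vector by \<open>- d\<close> gives
        \<open>w\<close>, with value \<open>- d * qform a' S v\<close>.\<close>
      define w where "w i = (if i = k then B else - d * v i)" for i
      have nk: "j \<in> S \<Longrightarrow> j \<noteq> k" for j using insert.hyps by auto
      have "(\<Sum>j\<in>S. a k j * w j) = (\<Sum>j\<in>S. - d * (a k j * v j))"
        using nk by (intro sum.cong) (auto simp: w_def)
      also have "\<dots> = - d * B" unfolding B_def by (rule sum_distrib_left[symmetric])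
      finally have lin: "(\<Sum>j\<in>S. a k j * w j) = - d * B" .
      have "qform a S w = qform a S (\<lambda>i. - d * v i)"
        using nk by (intro qform_cong) (auto simp: w_def)
      also have "\<dots> = (- d)\<^sup>2 * qform a S v" by (rule qform_scale)
      finally have "qform a (insert k S) w = d * B\<^sup>2 + 2 * B * (- d * B) + (- d)\<^sup>2 * qform a S v"
        unfolding ins lin by (simp add: w_def d_def)
      also have "\<dots> = - d * (B\<^sup>2 - d * qform a S v)"
        by (simp add: power2_eq_square algebra_simps)
      also have "B\<^sup>2 - d * qform a S v = qform a' S v"
        unfolding a'_def B_def by (rule qform_schur[symmetric])
      finally have "lead_coeff (qform a (insert k S) w) > 0"
        using lead_coeff_mult_pos[OF d v] by simp
      then show ?thesis by blast
    next
      assume "eventually (\<lambda>x. \<forall>w. qform (\<lambda>i j. poly (a' i j) x) S w \<le> 0) at_top"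
      with eventually_poly_pos[OF d]
      have "eventually (\<lambda>x. \<forall>w. qform (\<lambda>i j. poly (a i j) x) (insert k S) w \<le> 0) at_top"
      proof eventually_elim
        case (elim x)
        show ?case
        proof
          fix w
          define e where "e = poly d x"
          define B where "B = (\<Sum>j\<in>S. poly (a k j) x * w j)"
          define Q where "Q = qform (\<lambda>i j. poly (a i j) x) S w"
          have e: "e < 0" using elim(1) by (simp add: e_def)
          have "B\<^sup>2 - e * Q \<le> 0"
            using spec[OF elim(2), of w] unfolding a'_x B_def e_def Q_def .
          \<comment> \<open>Completing the square in \<open>w k\<close>, multiplied by the positive
            number \<open>- e\<close>.\<close>
          moreover have "- e * (e * (w k)\<^sup>2 + 2 * w k * B + Q) = (B\<^sup>2 - e * Q) - (e * w k + B)\<^sup>2"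
            by (simp add: power2_eq_square algebra_simps)
          ultimately have "- e * (e * (w k)\<^sup>2 + 2 * w k * B + Q) \<le> 0"
            using zero_le_power2[of "e * w k + B"] by linarith
          then have "e * (w k)\<^sup>2 + 2 * w k * B + Q \<le> 0"
            using e by (simp add: mult_le_0_iff zero_le_mult_iff)
          then show "qform (\<lambda>i j. poly (a i j) x) (insert k S) w \<le> 0"
            unfolding ins_x by (simp add: e_def B_def Q_def d_def)
        qed
      qed
      then show ?thesis by blast
    qed
  qed
qed

text \<open>Lists encode finite sums: appending adds values, and scaling all vectors by
  \<open>q\<close> multiplies the sum by \<open>q\<^sup>2\<close>.\<close>

lemma square_cone_qform: "square_cone (range (\<lambda>vs. \<Sum>v\<leftarrow>vs. qform a S v))"
proof
  show "0 \<in> range (\<lambda>vs. \<Sum>v\<leftarrow>vs. qform a S v)" by (rule range_eqI[of _ _ "[]"]) simp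
next
  fix g h assume "g \<in> range (\<lambda>vs. \<Sum>v\<leftarrow>vs. qform a S v)" "h \<in> range (\<lambda>vs. \<Sum>v\<leftarrow>vs. qform a S v)"
  then obtain vs ws where "g = (\<Sum>v\<leftarrow>vs. qform a S v)" "h = (\<Sum>v\<leftarrow>ws. qform a S v)" by blast
  then show "g + h \<in> range (\<lambda>vs. \<Sum>v\<leftarrow>vs. qform a S v)"
    by (intro range_eqI[of _ _ "vs @ ws"]) simp
next
  fix g q assume "g \<in> range (\<lambda>vs. \<Sum>v\<leftarrow>vs. qform a S v)"
  then obtain vs where "g = (\<Sum>v\<leftarrow>vs. qform a S v)" by blast
  then show "q\<^sup>2 * g \<in> range (\<lambda>vs. \<Sum>v\<leftarrow>vs. qform a S v)"
    by (intro range_eqI[of _ _ "map (\<lambda>v i. q * v i) vs"])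
      (simp add: o_def qform_scale sum_list_const_mult)
qed

text \<open>Constant vectors give positivity at each point, elimination gives it near both
  infinities, so the cone of values has a member positive everywhere. A constant square factor makes
  it 1 plus squares.\<close>

lemma sum_qform_minus_one_sum_squares:
  fixes a :: "'i \<Rightarrow> 'i \<Rightarrow> real poly"
  assumes "finite S" and sym: "\<And>i j. a i j = a j i"
    and pos: "\<And>x. \<exists>w. qform (\<lambda>i j. poly (a i j) x) S w > 0"
  obtains vs n q where "(\<Sum>v\<leftarrow>vs. qform a S v) - 1 = (\<Sum>i<(n::nat). (q i)\<^sup>2)"
proof -
  define N where "N = range (\<lambda>vs. \<Sum>v\<leftarrow>vs. qform a S v)"
  interpret square_cone N unfolding N_def by (rule square_cone_qform)
  have mem: "qform a S v \<in> N" for v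
    unfolding N_def by (rule range_eqI[of _ _ "[v]"]) simp
  \<comment> \<open>Stated for arbitrary \<open>b\<close> because it serves both \<open>a\<close>
    and its reflection. Without such a vector the form would be nonpositive at all large
    \<open>x\<close>.\<close>
  have pos_vector: "\<exists>v. lead_coeff (qform b S v) > 0"
    if "\<And>i j. b i j = b j i" "\<And>x. \<exists>w. qform (\<lambda>i j. poly (b i j) x) S w > 0" for b :: "'i \<Rightarrow> 'i \<Rightarrow> real poly"
  proof (rule ccontr)
    assume "\<nexists>v. lead_coeff (qform b S v) > 0"
    then have "eventually (\<lambda>x. \<forall>w. qform (\<lambda>i j. poly (b i j) x) S w \<le> 0) at_top"
      using eventually_qform_nonpos_or_pos_vector[OF assms(1), of b, OF that(1)] by blast
    then obtain x where "\<forall>w. qform (\<lambda>i j. poly (b i j) x) S w \<le> 0"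
      using eventually_happens' trivial_limit_at_top_linorder by blast
    with that(2)[of x] show False by (meson not_le)
  qed
  have "\<exists>g\<in>N. poly g x > 0" for x
  proof -
    obtain w where "qform (\<lambda>i j. poly (a i j) x) S w > 0" using pos by blast
    then have "poly (qform a S (\<lambda>i. [:w i:])) x > 0" by (simp add: poly_qform)
    with mem show ?thesis by blast
  qed
  moreover have "\<exists>g\<in>N. lead_coeff g > 0" using pos_vector[of a, OF sym pos] mem by blast
  moreover have "\<exists>g\<in>N. lead_coeff (reflect_arg g) > 0"
  proof -
    have "\<exists>v. lead_coeff (qform (\<lambda>i j. reflect_arg (a i j)) S v) > 0"
    proof (rule pos_vector)
      show "reflect_arg (a i j) = reflect_arg (a j i)" for i j by (simp add: sym[of i j])
      show "\<exists>w. qform (\<lambda>i j. poly (reflect_arg (a i j)) x) S w > 0" for x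
        using pos[of "- x"] by simp
    qed
    then obtain v where v: "lead_coeff (qform (\<lambda>i j. reflect_arg (a i j)) S v) > 0" by blast
    \<comment> \<open>Reflection is an involutive ring homomorphism, so the vector found for the
      reflected form yields a member of \<open>N\<close> after reflecting its entries.\<close>
    have "qform (\<lambda>i j. reflect_arg (a i j)) S v = reflect_arg (qform a S (\<lambda>i. reflect_arg (v i)))"
      by (subst poly_eq_poly_eq_iff[symmetric]) (auto simp: fun_eq_iff poly_qform)
    with v mem show ?thesis by metis
  qed
  ultimately obtain g where g: "g \<in> N" "\<And>x. poly g x > 0" by (rule pos_everywhere) blast
  obtain c n q where c: "[:c:]\<^sup>2 * g - 1 = (\<Sum>i<(n::nat). (q i)\<^sup>2)"
    using pos_poly_minus_one_sum_squares[OF g(2)] by metis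
  have "[:c:]\<^sup>2 * g \<in> N" using g(1) by (rule square_mult_mem)
  then obtain vs where "[:c:]\<^sup>2 * g = (\<Sum>v\<leftarrow>vs. qform a S v)" unfolding N_def by blast
  with c have "(\<Sum>v\<leftarrow>vs. qform a S v) - 1 = (\<Sum>i<n. (q i)\<^sup>2)" by (simp only:)
  then show ?thesis by (rule that)
qed

section \<open>Passage between matrices and quadratic forms\<close>

lemma neg_semidef_iff_qform:
  assumes "symmetric_matrix A"
  shows "neg_semidef A \<longleftrightarrow> (\<forall>w. qform (\<lambda>i j. A $ i $ j) UNIV w \<le> 0)"
proof -
  have "symmetric_matrix (- A)"
    using assms by (simp add: symmetric_matrix_def transpose_def vec_eq_iff)
  moreover have "v \<bullet> (- A *v v) = - qform (\<lambda>i j. A $ i $ j) UNIV (($) v)" for v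
    by (simp add: inner_vec_def matrix_vector_mult_def qform_def sum_distrib_left sum_negf mult_ac)
  moreover have "(\<forall>v :: real ^ 'a. P (($) v)) \<longleftrightarrow> (\<forall>w. P w)" for P
  proof
    assume *: "\<forall>v :: real ^ 'a. P (($) v)"
    have "P w" for w using spec[OF *, of "vec_lambda w"] by (simp add: vec_lambda_inverse)
    then show "\<forall>w. P w" ..
  qed simp
  ultimately show ?thesis
    unfolding neg_semidef_def pos_semidef_def by simp
qed

lemma congruence_entry:
  fixes f :: "'a::comm_ring_1 ^ 'n ^ 'n" and p :: "'a ^ 'm ^ 'n"
  shows "(transpose p ** f ** p) $ r $ s = (\<Sum>k\<in>UNIV. \<Sum>l\<in>UNIV. p $ k $ r * f $ k $ l * p $ l $ s)"
  unfolding matrix_matrix_mult_def transpose_def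
  by (simp add: sum_distrib_right) (rule sum.swap)

lemma mat_sum: "mat (sum g I) = (\<Sum>i\<in>I. mat (g i) :: 'a::comm_ring_1 ^ 'n ^ 'n)"
  by (simp add: vec_eq_iff mat_def)

lemma transpose_mat_mult_mat: "transpose (mat c) ** mat c = (mat (c\<^sup>2) :: 'a::comm_ring_1 ^ 'n ^ 'n)"
  by (simp add: vec_eq_iff matrix_matrix_mult_def transpose_def mat_def power2_eq_square
      if_distrib[of "\<lambda>x. x * _"] if_distrib[of "\<lambda>x. _ * x"] cong: if_cong)

text \<open>\<open>P j\<close> carries \<open>v\<close> in column \<open>j\<close> only, so its
  congruence has the value of the form at the diagonal position \<open>j\<close> and 0
  elsewhere.\<close>

lemma sum_congruence_single_column:
  fixes f :: "'a::comm_ring_1 ^ 'n ^ 'n" and v :: "'n \<Rightarrow> 'a"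
  defines "P \<equiv> \<lambda>j :: 'n. \<chi> r s. if s = j then v r else 0"
  shows "(\<Sum>j\<in>UNIV. transpose (P j) ** f ** P j) = mat (qform (\<lambda>i j. f $ i $ j) UNIV v)"
proof -
  have "(transpose (P j) ** f ** P j) $ r $ s =
      (if j = r then if r = s then qform (\<lambda>i j. f $ i $ j) UNIV v else 0 else 0)" for j r s
    unfolding congruence_entry by (auto simp: P_def qform_def)
  then show ?thesis by (simp add: vec_eq_iff mat_def)
qed

text \<open>Renumbers the matrices, which arise indexed by pairs of a vector and a column, by an
  initial segment of the naturals.\<close>

lemma ex_nat_indexed_sum:
  assumes "finite I"
  shows "\<exists>(n::nat) h. (\<Sum>i\<in>I. F (p i)) = (\<Sum>i<n. F (h i))"
proof -
  obtain b where "bij_betw b {0..<card I} I" using ex_bij_betw_nat_finite[OF assms] by blast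
  then have "(\<Sum>i\<in>I. F (p i)) = (\<Sum>i<card I. F (p (b i)))"
    by (simp add: sum.reindex_bij_betw[symmetric] lessThan_atLeast0)
  then show ?thesis by (intro exI[of _ "card I"] exI[of _ "\<lambda>i. p (b i)"])
qed

theorem theorem4:
  fixes f :: "real poly ^ 't ^ 't"
  assumes "symmetric_matrix f"
  shows "(\<forall>x :: real. \<not> neg_semidef (eval_mat f x)) \<longleftrightarrow>
    (\<exists>(n :: nat) (p :: nat \<Rightarrow> real poly ^ 't ^ 't).
       sum_of_hermitian_squares ((\<Sum>i<n. transpose (p i) ** f ** p i) - mat 1))"
proof -
  define a where "a i j = f $ i $ j" for i j
  have sym: "a i j = a j i" for i j
    using assms by (simp add: a_def symmetric_matrix_def transpose_def vec_eq_iff)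
  have "symmetric_matrix (eval_mat f x)" for x
    using sym by (simp add: symmetric_matrix_def eval_mat_def map_matrix_def transpose_def vec_eq_iff a_def)
  from neg_semidef_iff_qform[OF this]
  have nsd: "neg_semidef (eval_mat f x) \<longleftrightarrow> (\<forall>w. qform (\<lambda>i j. poly (a i j) x) UNIV w \<le> 0)" for x
    by (simp add: eval_mat_def map_matrix_def a_def)
  show ?thesis
  proof
    assume "\<forall>x. \<not> neg_semidef (eval_mat f x)"
    then have "\<exists>w. qform (\<lambda>i j. poly (a i j) x) UNIV w > 0" for x
      unfolding nsd by (meson not_le)
    from sum_qform_minus_one_sum_squares[OF finite sym this]
    obtain vs and n :: nat and q where q: "(\<Sum>v\<leftarrow>vs. qform a UNIV v) - 1 = (\<Sum>i<n. (q i)\<^sup>2)" .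
    define P :: "nat \<times> 't \<Rightarrow> real poly ^ 't ^ 't"
      where "P = (\<lambda>(i, j). \<chi> r s. if s = j then (vs ! i) r else 0)"
    define F where "F p = transpose p ** f ** p" for p :: "real poly ^ 't ^ 't"
    have "(\<Sum>ij\<in>{..<length vs} \<times> UNIV. F (P ij)) = (\<Sum>i<length vs. \<Sum>j\<in>UNIV. F (P (i, j)))"
      by (simp add: sum.cartesian_product case_prod_beta)
    also have "\<dots> = (\<Sum>i<length vs. mat (qform a UNIV (vs ! i)))"
      unfolding F_def P_def by (simp add: sum_congruence_single_column a_def[abs_def])
    also have "\<dots> = mat (\<Sum>v\<leftarrow>vs. qform a UNIV v)"
      by (simp add: mat_sum[symmetric] sum_list_sum_nth lessThan_atLeast0)
    finally have PF: "(\<Sum>ij\<in>{..<length vs} \<times> UNIV. F (P ij)) = mat (\<Sum>v\<leftarrow>vs. qform a UNIV v)" .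
    obtain m :: nat and p where p: "(\<Sum>ij\<in>{..<length vs} \<times> UNIV. F (P ij)) = (\<Sum>i<m. F (p i))"
      using ex_nat_indexed_sum[of "{..<length vs} \<times> (UNIV :: 't set)" F P] by auto
    have "(\<Sum>i<m. F (p i)) - mat 1 = mat ((\<Sum>v\<leftarrow>vs. qform a UNIV v) - 1)"
      unfolding p[symmetric] PF by (simp add: vec_eq_iff mat_def)
    also have "\<dots> = (\<Sum>i<n. transpose (mat (q i)) ** mat (q i))"
      unfolding q mat_sum transpose_mat_mult_mat ..
    finally have "sum_of_hermitian_squares ((\<Sum>i<m. F (p i)) - mat 1)"
      unfolding sum_of_hermitian_squares_def hermitian_square_def
      by (intro exI[of _ n] exI[of _ "\<lambda>i. transpose (mat (q i)) ** mat (q i)"]) blast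
    then show "\<exists>(n :: nat) (p :: nat \<Rightarrow> real poly ^ 't ^ 't).
       sum_of_hermitian_squares ((\<Sum>i<n. transpose (p i) ** f ** p i) - mat 1)"
      unfolding F_def by (intro exI[of _ m] exI[of _ p])
  next
    assume "\<exists>(n :: nat) (p :: nat \<Rightarrow> real poly ^ 't ^ 't).
       sum_of_hermitian_squares ((\<Sum>i<n. transpose (p i) ** f ** p i) - mat 1)"
    then obtain n and p :: "nat \<Rightarrow> real poly ^ 't ^ 't" and m and S :: "nat \<Rightarrow> real poly ^ 't ^ 't"
      where S: "\<forall>j<m. \<exists>A :: real poly ^ 't ^ 't. S j = transpose A ** A"
        and sum_S: "(\<Sum>i<n. transpose (p i) ** f ** p i) - mat 1 = (\<Sum>j<m. S j)"
      unfolding sum_of_hermitian_squares_def hermitian_square_def by (elim exE conjE) (rule that)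
    from S obtain B :: "nat \<Rightarrow> real poly ^ 't ^ 't" where "\<And>j. j < m \<Longrightarrow> S j = transpose (B j) ** B j" by metis
    with sum_S have eq:
      "(\<Sum>i<n. transpose (p i) ** f ** p i) - mat 1 = (\<Sum>j<m. transpose (B j) ** B j)" by simp
    show "\<forall>x. \<not> neg_semidef (eval_mat f x)"
    proof (intro allI notI)
      fix x assume "neg_semidef (eval_mat f x)"
      then have le: "qform (\<lambda>i j. poly (a i j) x) UNIV w \<le> 0" for w using nsd by blast
      \<comment> \<open>Any diagonal position serves. At \<open>x\<close> the entry on the left is
        at most -1, while each \<open>transpose (B j) ** B j\<close> contributes a sum of
        squares.\<close>
      fix k :: 't
      have "(\<Sum>i<n. qform a UNIV (\<lambda>l. p i $ l $ k)) - 1 = (\<Sum>j<m. \<Sum>l\<in>UNIV. (B j $ l $ k)\<^sup>2)"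
        using arg_cong[OF eq, of "\<lambda>A. A $ k $ k"]
        by (simp add: congruence_entry qform_def a_def mat_def)
          (simp add: matrix_matrix_mult_def transpose_def power2_eq_square)
      from arg_cong[OF this, of "\<lambda>g. poly g x"]
      have "(\<Sum>i<n. poly (qform a UNIV (\<lambda>l. p i $ l $ k)) x) - 1 =
          (\<Sum>j<m. \<Sum>l\<in>UNIV. (poly (B j $ l $ k) x)\<^sup>2)"
        by (simp add: poly_sum)
      moreover have "(\<Sum>i<n. poly (qform a UNIV (\<lambda>l. p i $ l $ k)) x) \<le> 0"
        unfolding poly_qform by (intro sum_nonpos le)
      moreover have "(\<Sum>j<m. \<Sum>l\<in>UNIV. (poly (B j $ l $ k) x)\<^sup>2) \<ge> 0" by (intro sum_nonneg) simp
      ultimately show False by linarith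
    qed
  qed
qed

end
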